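(* Let $\mathcal{T}=(Q,\Sigma,\delta)$ be a complete and reversible $S$-automaton such that the semigroup $\mathscr{S}(\mathcal{T})$ generated by $\mathcal{T}$ is infinite. Then every word $u\in\Sigma^*$ is expandable (with respect to $\mathcal{T}$) by a word $x\in\Sigma^*$ of length at most $|Q|^n$, where $n=|Q^*\circ u|$.
   Context: An alphabet is a non-empty finite set; $\Sigma^*$ is the set of finite words over $\Sigma$, including the empty word $\varepsilon$. An automaton is a triple $\mathcal{T}=(Q,\Sigma,\delta)$ with a finite set $Q$ of states, an alphabet $\Sigma$ and $\delta\subseteq Q\times\Sigma\times\Sigma\times Q$; a transition $(q,a,b,p)$ goes from $q$ to $p$, reads $a$ and outputs $b$. An $S$-automaton is a deterministic automaton: for all $q\in Q,a\in\Sigma$ there is at most one transition $(q,a,b,p)\in\delta$. It is complete if there is at least one such transition for all $q\in Q,a\in\Sigma$. It is reversible if for all $q\in Q,a\in\Sigma$ there is at most one transition of the form $(p,a,b,q)\in\delta$ with $p\in Q,b\in\Sigma$ (at most one incoming transition with input $a$). For a complete $S$-automaton, each $q\in Q$ induces a total length-preserving function $q\circ\colon\Sigma^*\to\Sigma^*$ mapping $u$ to the output of the unique run starting in $q$ with input $u$. For $\boldsymbol q=q_\ell\dots q_1\in Q^*$, $\boldsymbol q\circ$ is the composition applying $q_1\circ$ first and $q_\ell\circ$ last; $\varepsilon\circ$ is the identity. The semigroup generated by $\mathcal{T}$ is $\mathscr{S}(\mathcal{T})=\{\boldsymbol q\circ\mid\boldsymbol q\in Q^+\}$ under composition, where $Q^+$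 is the set of non-empty finite sequences over $Q$. The orbit of $u$ is $Q^*\circ u=\{\boldsymbol q\circ u\mid\boldsymbol q\in Q^*\}$. The word $u$ is expandable by $x$ if $|Q^*\circ ux|>|Q^*\circ u|$. *)

theory Defs
  imports Main "HOL-Library.FuncSet"
begin

record ('q, 'a) automaton =
  states :: "'q set"
  alphabet :: "'a set"
  transitions :: "('q \<times> 'a \<times> 'a \<times> 'q) set"  \<comment> \<open>source, input, output, target\<close>

definition is_automaton :: "('q, 'a) automaton \<Rightarrow> bool" where
  "is_automaton T \<longleftrightarrow>
     finite (states T) \<and> finite (alphabet T) \<and> alphabet T \<noteq> {} \<and>
     transitions T \<subseteq> states T \<times> alphabet T \<times> alphabet T \<times> states T"

definition S_automaton :: "('q, 'a) automaton \<Rightarrow> bool" where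
  "S_automaton T \<longleftrightarrow> is_automaton T \<and>
     (\<forall>q\<in>states T. \<forall>a\<in>alphabet T. \<forall>b p b' p'.
        (q, a, b, p) \<in> transitions T \<and> (q, a, b', p') \<in> transitions T \<longrightarrow> b = b' \<and> p = p')"

definition complete_automaton :: "('q, 'a) automaton \<Rightarrow> bool" where
  "complete_automaton T \<longleftrightarrow>
     (\<forall>q\<in>states T. \<forall>a\<in>alphabet T. \<exists>b p. (q, a, b, p) \<in> transitions T)"

definition reversible_automaton :: "('q, 'a) automaton \<Rightarrow> bool" where
  "reversible_automaton T \<longleftrightarrow>
     (\<forall>q\<in>states T. \<forall>a\<in>alphabet T. \<forall>p b p' b'.
        (p, a, b, q) \<in> transitions T \<and> (p', a, b', q) \<in> transitions T \<longrightarrow> p = p' \<and> b = b')"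

text \<open>\<open>run T q u v p\<close>: there is a run of \<open>T\<close> from \<open>q\<close> to \<open>p\<close> with input \<open>u\<close> and output \<open>v\<close>.\<close>

inductive run :: "('q, 'a) automaton \<Rightarrow> 'q \<Rightarrow> 'a list \<Rightarrow> 'a list \<Rightarrow> 'q \<Rightarrow> bool"
  for T :: "('q, 'a) automaton" where
  run_Nil: "q \<in> states T \<Longrightarrow> run T q [] [] q"
| run_Cons: "(q, a, b, r) \<in> transitions T \<Longrightarrow> run T r u v p \<Longrightarrow> run T q (a # u) (b # v) p"

text \<open>Functions on words over the alphabet are restricted to those words (with value
  \<^term>\<open>undefined\<close> elsewhere), so that equality in HOL is equality of functions on that domain.\<close>

definition state_fun :: "('q, 'a) automaton \<Rightarrow> 'q \<Rightarrow> 'a list \<Rightarrow> 'a list" where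
  "state_fun T q = (\<lambda>u\<in>lists (alphabet T). THE v. \<exists>p. run T q u v p)"

text \<open>The list \<open>[q\<^sub>l, \<dots>, q\<^sub>1]\<close> stands for the sequence \<open>q\<^sub>l \<dots> q\<^sub>1\<close>: its last entry acts first.\<close>

primrec seq_fun :: "('q, 'a) automaton \<Rightarrow> 'q list \<Rightarrow> 'a list \<Rightarrow> 'a list" where
  "seq_fun T [] = (\<lambda>u\<in>lists (alphabet T). u)"
| "seq_fun T (q # qs) = compose (lists (alphabet T)) (state_fun T q) (seq_fun T qs)"

text \<open>The carrier of the generated semigroup; its operation is
  \<^term>\<open>compose (lists (alphabet T))\<close>.\<close>

definition generated_semigroup :: "('q, 'a) automaton \<Rightarrow> ('a list \<Rightarrow> 'a list) set" where
  "generated_semigroup T = {seq_fun T qs | qs. qs \<in> lists (states T) \<and> qs \<noteq> []}"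

definition orbit :: "('q, 'a) automaton \<Rightarrow> 'a list \<Rightarrow> 'a list set" where
  "orbit T u = {seq_fun T qs u | qs. qs \<in> lists (states T)}"

definition expandable :: "('q, 'a) automaton \<Rightarrow> 'a list \<Rightarrow> 'a list \<Rightarrow> bool" where
  "expandable T u x \<longleftrightarrow> card (orbit T (u @ x)) > card (orbit T u)"

end

theory Submission
  imports Defs
begin

text \<open>
  Write \<open>p \<cdot> w\<close> for the state sequence reached from \<open>p\<close> on reading \<open>w\<close>, so that
  \<open>p \<circ> wx = (p \<circ> w)((p \<cdot> w) \<circ> x)\<close>. Choose a suffix-closed transversal \<open>R\<close> of the sequences for
  the map \<open>p \<mapsto> p \<circ> u\<close>, a spanning tree of the orbit. Reversibility makes \<open>p \<mapsto> p \<cdot> u\<close> onto, so if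
  \<open>p \<circ> u\<close> always determined the function \<open>(p \<cdot> u) \<circ>\<close>, the semigroup would have at most \<open>n\<close>
  elements. Hence it fails already at some edge outside the tree: there are \<open>e = q r\<close> with
  \<open>r \<in> R\<close> and \<open>r' \<in> R\<close> such that \<open>e \<circ> u = r' \<circ> u\<close> but \<open>e \<cdot> u\<close> and \<open>r' \<cdot> u\<close> differ on some
  word. While reading such a word, all sections of \<open>R\<close> and \<open>e\<close> are determined by one state for
  each of the \<open>n - 1\<close> tree edges and one for the last letter of \<open>e\<close>. A shortest such word visits
  no configuration twice before its end, so its length is at most \<open>|Q|\<^sup>n\<close>.
\<close>

text \<open>Adding an edge to a tree: \<open>q # r\<close> becomes a new leaf, since its tail
  \<open>r\<close> is already a vertex.\<close>

lemma injective_suffix_closed_insert: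
  assumes "inj_on f R" "\<forall>q p. q # p \<in> R \<longrightarrow> p \<in> R" "r \<in> R" "f (q # r) \<notin> f ` R"
  shows "inj_on f (insert (q # r) R)" "\<forall>q' p. q' # p \<in> insert (q # r) R \<longrightarrow> p \<in> insert (q # r) R"
  using assms by (auto simp: inj_on_insert)

section \<open>Runs, outputs and sections as total functions\<close>

locale complete_S_automaton =
  fixes T :: "('q, 'a) automaton"
  assumes S_automaton: "S_automaton T" and complete: "complete_automaton T"
begin

abbreviation "Q \<equiv> states T"
abbreviation "A \<equiv> alphabet T"

definition out :: "'q \<Rightarrow> 'a \<Rightarrow> 'a" where
  "out q a = (THE b. \<exists>p. (q, a, b, p) \<in> transitions T)"

definition nxt :: "'q \<Rightarrow> 'a \<Rightarrow> 'q" where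
  "nxt q a = (THE p. \<exists>b. (q, a, b, p) \<in> transitions T)"

primrec word_out :: "'q \<Rightarrow> 'a list \<Rightarrow> 'a list" where
  "word_out q [] = []"
| "word_out q (a # w) = out q a # word_out (nxt q a) w"

primrec target :: "'q \<Rightarrow> 'a list \<Rightarrow> 'q" where
  "target q [] = q"
| "target q (a # w) = target (nxt q a) w"

text \<open>Unlike \<open>seq_fun\<close>, this is not restricted to words over the alphabet, so the
  laws for concatenation hold without side conditions.\<close>

primrec act :: "'q list \<Rightarrow> 'a list \<Rightarrow> 'a list" where
  "act [] w = w"
| "act (q # qs) w = word_out q (act qs w)"

text \<open>The dual action of words on state sequences: each state reads what the entries behind it
  output.\<close>

primrec section_of :: "'q list \<Rightarrow> 'a list \<Rightarrow> 'q list" where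
  "section_of [] w = []"
| "section_of (q # qs) w = target q (act qs w) # section_of qs w"

lemma finite_Q: "finite Q" and finite_A: "finite A"
  and transitions_subset: "transitions T \<subseteq> Q \<times> A \<times> A \<times> Q"
  using S_automaton by (auto simp: S_automaton_def is_automaton_def)

lemma transitions_iff:
  assumes "q \<in> Q" "a \<in> A"
  shows "(q, a, b, p) \<in> transitions T \<longleftrightarrow> b = out q a \<and> p = nxt q a"
proof -
  obtain b' p' where t: "(q, a, b', p') \<in> transitions T"
    using complete assms unfolding complete_automaton_def by blast
  have u: "c = b' \<and> r = p'" if "(q, a, c, r) \<in> transitions T" for c r
    using S_automaton assms t that unfolding S_automaton_def by blast
  have "out q a = b'" "nxt q a = p'"
    unfolding out_def nxt_def by (rule the_equality; use t u in blast)+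
  then show ?thesis using t u by blast
qed

lemma
  assumes "q \<in> Q" "a \<in> A"
  shows out_in_A: "out q a \<in> A" and nxt_in_Q: "nxt q a \<in> Q"
  using transitions_iff[OF assms] transitions_subset by auto

lemma run_iff:
  assumes "q \<in> Q" "w \<in> lists A"
  shows "run T q w v p \<longleftrightarrow> v = word_out q w \<and> p = target q w"
  using assms
proof (induction w arbitrary: q v)
  case Nil
  then show ?case by (subst run.simps) auto
next
  case (Cons a w)
  then have a: "a \<in> A" "w \<in> lists A" by auto
  have "run T q (a # w) v p \<longleftrightarrow>
      (\<exists>b r v'. v = b # v' \<and> (q, a, b, r) \<in> transitions T \<and> run T r w v' p)"
    by (subst run.simps) auto
  also have "\<dots> \<longleftrightarrow> (\<exists>v'. v = out q a # v' \<and> run T (nxt q a) w v' p)"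
    using transitions_iff[OF Cons.prems(1) a(1)] by auto
  finally show ?case
    using Cons.IH[OF nxt_in_Q[OF Cons.prems(1) a(1)] a(2)] by auto
qed

lemma state_fun_eq:
  assumes "q \<in> Q" "w \<in> lists A"
  shows "state_fun T q w = word_out q w"
proof -
  have "(\<exists>p. run T q w v p) \<longleftrightarrow> v = word_out q w" for v
    using assms by (simp add: run_iff)
  then show ?thesis using assms(2) by (simp add: state_fun_def)
qed

lemma word_out_in_lists: "q \<in> Q \<Longrightarrow> w \<in> lists A \<Longrightarrow> word_out q w \<in> lists A"
  by (induction w arbitrary: q) (auto simp: out_in_A nxt_in_Q)

lemma target_in_Q: "q \<in> Q \<Longrightarrow> w \<in> lists A \<Longrightarrow> target q w \<in> Q"
  by (induction w arbitrary: q) (auto simp: nxt_in_Q)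

lemma act_in_lists: "p \<in> lists Q \<Longrightarrow> w \<in> lists A \<Longrightarrow> act p w \<in> lists A"
  by (induction p) (auto simp: word_out_in_lists)

lemma section_of_in_lists: "p \<in> lists Q \<Longrightarrow> w \<in> lists A \<Longrightarrow> section_of p w \<in> lists Q"
  by (induction p) (auto simp: target_in_Q act_in_lists)

lemma seq_fun_eq:
  assumes "p \<in> lists Q"
  shows "seq_fun T p = restrict (act p) (lists A)"
  using assms
proof (induction p)
  case (Cons q p)
  then have q: "q \<in> Q" and p: "p \<in> lists Q" by auto
  show ?case
    unfolding seq_fun.simps compose_def Cons.IH
    by (rule restrict_ext) (simp add: state_fun_eq[OF q act_in_lists[OF p]] del: in_lists_conv_set)
qed simp

lemma orbit_eq:
  assumes "u \<in> lists A"
  shows "orbit T u = (\<lambda>p. act p u) ` lists Q"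
proof -
  have "seq_fun T p u = act p u" if "p \<in> lists Q" for p
    using that assms by (simp add: seq_fun_eq)
  then show ?thesis
    unfolding orbit_def by force
qed

section \<open>Orbits and prefixes\<close>

lemma length_word_out [simp]: "length (word_out q w) = length w"
  by (induction w arbitrary: q) auto

lemma length_act [simp]: "length (act p w) = length w"
  by (induction p) auto

lemma finite_orbit: "u \<in> lists A \<Longrightarrow> finite (orbit T u)"
  by (rule finite_subset[OF _ finite_lists_length_eq[OF finite_A, of "length u"]])
     (use act_in_lists in \<open>fastforce simp: orbit_eq in_lists_conv_set\<close>)

lemma word_out_append: "word_out q (v @ w) = word_out q v @ word_out (target q v) w"
  by (induction v arbitrary: q) auto

lemma target_append: "target q (v @ w) = target (target q v) w"
  by (induction v arbitrary: q) auto

lemma act_append: "act p (v @ w) = act p v @ act (section_of p v) w"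
  by (induction p) (auto simp: word_out_append)

lemma section_of_append: "section_of p (v @ w) = section_of (section_of p v) w"
  by (induction p) (auto simp: act_append target_append)

text \<open>Truncation to the length of \<open>u\<close> maps the orbit of \<open>u @ x\<close> onto
  that of \<open>u\<close>; \<open>p\<close> and \<open>r\<close> witness that it is not
  injective.\<close>

lemma expandableI:
  assumes "u \<in> lists A" "x \<in> lists A" "p \<in> lists Q" "r \<in> lists Q"
    and eq: "act p u = act r u" and neq: "act p (u @ x) \<noteq> act r (u @ x)"
  shows "expandable T u x"
proof -
  let ?O = "orbit T (u @ x)" and ?f = "take (length u)"
  have take_act: "?f (act s (u @ x)) = act s u" for s
    by (simp add: act_append)
  have ux: "u @ x \<in> lists A" using assms by simp
  have img: "?f ` ?O = orbit T u"
    unfolding orbit_eq[OF ux] orbit_eq[OF assms(1)] image_image take_act ..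
  have "\<not> inj_on ?f ?O"
    using assms(3,4) eq neq take_act orbit_eq[OF ux] by (metis inj_onD image_eqI)
  then have "card (?f ` ?O) \<noteq> card ?O"
    using finite_orbit[OF ux] eq_card_imp_inj_on by blast
  then show ?thesis
    using card_image_le[OF finite_orbit[OF ux], of ?f] img by (simp add: expandable_def)
qed

section \<open>Spanning trees of the orbit\<close>

lemma suffix_closed_transversal:
  assumes "u \<in> lists A"
  obtains R where "R \<subseteq> lists Q" "[] \<in> R" "\<forall>q p. q # p \<in> R \<longrightarrow> p \<in> R"
    "bij_betw (\<lambda>p. act p u) R (orbit T u)"
proof -
  let ?f = "\<lambda>p. act p u"
  define P where "P R \<longleftrightarrow> R \<subseteq> lists Q \<and> [] \<in> R \<and> (\<forall>q p. q # p \<in> R \<longrightarrow> p \<in> R) \<and> inj_on ?f R" for R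
  have sub: "?f ` R \<subseteq> orbit T u" if "P R" for R
    using that by (auto simp: P_def orbit_eq[OF assms])
  have inj: "inj_on ?f R" if "P R" for R using that by (simp add: P_def)
  have card_le: "card R \<le> card (orbit T u)" if "P R" for R
    by (rule card_inj_on_le[OF inj[OF that] sub[OF that] finite_orbit[OF assms]])
  have fin: "finite R" if "P R" for R
    by (rule inj_on_finite[OF inj[OF that] sub[OF that] finite_orbit[OF assms]])
  have "P {[]}" by (simp add: P_def)
  \<comment> \<open>Every partial transversal embeds into the finite orbit, so one of greatest
    cardinality exists.\<close>
  then obtain R where R: "P R" and max: "\<And>S. P S \<Longrightarrow> card S \<le> card R"
    using ex_has_greatest_nat[of P "{[]}" card "Suc (card (orbit T u))"] card_le
    by (metis less_Suc_eq_le)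
  \<comment> \<open>A missed value would be a leaf to add, against maximality.\<close>
  have step: "act (q # r) u \<in> ?f ` R" if "q \<in> Q" "r \<in> R" for q r
  proof (rule ccontr)
    assume new: "act (q # r) u \<notin> ?f ` R"
    have closed: "\<forall>q p. q # p \<in> R \<longrightarrow> p \<in> R" using R by (simp add: P_def)
    have "r \<in> lists Q" "R \<subseteq> lists Q" "[] \<in> R"
      using R that(2) by (auto simp: P_def)
    then have "insert (q # r) R \<subseteq> lists Q" "[] \<in> insert (q # r) R"
      using that(1) by simp_all
    then have "P (insert (q # r) R)"
      unfolding P_def
      using injective_suffix_closed_insert[of ?f R r q, OF inj[OF R] closed that(2) new] by blast
    moreover have "q # r \<notin> R" using new by blast
    ultimately show False
      using max[of "insert (q # r) R"] fin[OF R] by simp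
  qed
  \<comment> \<open>\<open>act (q # p) u\<close> depends on \<open>p\<close> only through
    \<open>act p u\<close>, so \<open>p\<close> may be replaced by its representative in
    \<open>R\<close>.\<close>
  have "act p u \<in> ?f ` R" if "p \<in> lists Q" for p
    using that
  proof (induction p)
    case Nil
    have "[] \<in> R" using R by (simp add: P_def)
    then show ?case by (rule imageI)
  next
    case (Cons q p)
    then obtain r where "r \<in> R" "act p u = act r u" by blast
    then show ?case using step[of q r] Cons by simp
  qed
  then have "?f ` R = orbit T u"
    using sub[OF R] by (auto simp: orbit_eq[OF assms])
  then show thesis
    using R that by (auto simp: P_def bij_betw_def)
qed

section \<open>Shortest distinguishing words\<close>

lemma section_of_eqI:
  assumes "\<forall>q p. q # p \<in> D \<longrightarrow> p = [] \<or> p \<in> D"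
    and "\<And>p. p \<in> D \<Longrightarrow> hd (section_of p v) = hd (section_of p w)" and "p \<in> D"
  shows "section_of p v = section_of p w"
  using assms(3)
proof (induction p)
  case (Cons q p)
  moreover have "section_of p v = section_of p w"
    using assms(1) Cons by (cases "p = []") auto
  ultimately show ?case using assms(2)[of "q # p"] by simp
qed simp

lemma short_distinguishing_word:
  assumes D: "finite D" "D \<subseteq> lists Q" "[] \<notin> D" "\<forall>q p. q # p \<in> D \<longrightarrow> p = [] \<or> p \<in> D"
    and e: "e \<in> D" and r: "r = [] \<or> r \<in> D" and u: "u \<in> lists A"
    and x: "x \<in> lists A" "act (section_of e u) x \<noteq> act (section_of r u) x"
  obtains y where "y \<in> lists A" "length y \<le> card Q ^ card D"
    "act (section_of e u) y \<noteq> act (section_of r u) y"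
proof -
  define B where "B y \<longleftrightarrow> y \<in> lists A \<and> act (section_of e u) y \<noteq> act (section_of r u) y" for y
  have "B x" using x by (simp add: B_def)
  then obtain y where y: "B y" and min: "\<And>z. B z \<Longrightarrow> length y \<le> length z"
    using ex_has_least_nat[of B x length] by blast
  have "length y \<le> card Q ^ card D"
  proof (rule ccontr)
    assume long: "\<not> length y \<le> card Q ^ card D"
    \<comment> \<open>The configuration after \<open>i\<close> letters of \<open>y\<close>: one
      state for each member of \<open>D\<close>. By suffix-closure these heads determine the full
      sections.\<close>
    define c where "c i = (\<lambda>p\<in>D. hd (section_of p (u @ take i y)))" for i
    have yA: "y \<in> lists A" using y by (simp add: B_def)
    have "c i \<in> D \<rightarrow>\<^sub>E Q" for i
      unfolding c_def
    proof (rule restrict_PiE_iff[THEN iffD2], rule ballI)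
      fix p assume p: "p \<in> D"
      have "take i y \<in> lists A" using yA by (auto dest: in_set_takeD)
      then have "section_of p (u @ take i y) \<in> lists Q"
        using p D(2) u by (intro section_of_in_lists) auto
      moreover have "section_of p (u @ take i y) \<noteq> []"
        using p D(3) by (cases p) auto
      ultimately show "hd (section_of p (u @ take i y)) \<in> Q"
        by (cases "section_of p (u @ take i y)") auto
    qed
    then have "c ` {..<length y} \<subseteq> D \<rightarrow>\<^sub>E Q" by blast
    then have "card (c ` {..<length y}) \<le> card (D \<rightarrow>\<^sub>E Q)"
      by (intro card_mono finite_PiE D(1) finite_Q)
    also have "\<dots> < card {..<length y}"
      using long D(1) by (simp add: card_PiE)
    \<comment> \<open>The positions strictly before the end already outnumber the configurations, so
      \<open>take j y\<close> below is a proper prefix.\<close>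
    finally have "\<not> inj_on c {..<length y}" by (rule pigeonhole)
    then obtain i j where ij: "i < j" "j < length y" and c: "c i = c j"
      by (metis lessThan_iff linorder_inj_onI')
    have sec: "section_of p (u @ take i y) = section_of p (u @ take j y)" if "p \<in> D" for p
    proof (rule section_of_eqI[OF D(4) _ that])
      fix p assume "p \<in> D"
      then show "hd (section_of p (u @ take i y)) = hd (section_of p (u @ take j y))"
        using fun_cong[OF c, of p] by (simp add: c_def)
    qed
    have sec_e: "section_of e (u @ take i y) = section_of e (u @ take j y)"
      and sec_r: "section_of r (u @ take i y) = section_of r (u @ take j y)"
      using sec e r by auto
    \<comment> \<open>Both words are shorter than \<open>y\<close>: a proper prefix, and
      \<open>y\<close> with the loop from \<open>i\<close> to \<open>j\<close> cut out. The first
      settles \<open>take j y\<close>, the second \<open>drop j y\<close>, as the sections at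
      \<open>i\<close> and \<open>j\<close> coincide.\<close>
    have "\<not> B (take j y)" "\<not> B (take i y @ drop j y)"
      using min[of "take j y"] min[of "take i y @ drop j y"] ij by auto
    moreover have "take j y \<in> lists A" "take i y @ drop j y \<in> lists A"
      using yA by (auto dest: in_set_takeD in_set_dropD)
    ultimately have "act (section_of e u) (take j y) = act (section_of r u) (take j y)"
      "act (section_of e (u @ take j y)) (drop j y) = act (section_of r (u @ take j y)) (drop j y)"
      using sec_e sec_r by (auto simp: B_def act_append section_of_append)
    then have "act (section_of e u) (take j y @ drop j y) = act (section_of r u) (take j y @ drop j y)"
      unfolding act_append by (simp add: section_of_append)
    then show False using y by (simp add: B_def)
  qed
  then show thesis using that y by (auto simp: B_def)
qed

section \<open>Reversibility and the length bound\<close>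

context
  assumes reversible: "reversible_automaton T"
begin

text \<open>By reversibility each letter acts injectively on the finite set \<open>Q\<close>, hence
  permutes it.\<close>

lemma target_surj:
  assumes "w \<in> lists A" "p \<in> Q"
  shows "\<exists>q\<in>Q. target q w = p"
  using assms
proof (induction w)
  case (Cons a w)
  then obtain r where r: "r \<in> Q" "target r w = p" by blast
  have a: "a \<in> A" using Cons by simp
  have "inj_on (\<lambda>q. nxt q a) Q"
  proof (rule inj_onI)
    fix q q' assume "q \<in> Q" "q' \<in> Q" "nxt q a = nxt q' a"
    then have "(q, a, out q a, nxt q a) \<in> transitions T \<and> (q', a, out q' a, nxt q a) \<in> transitions T"
      using a by (simp add: transitions_iff)
    then show "q = q'"
      using reversible[unfolded reversible_automaton_def, rule_format, OF nxt_in_Q[OF \<open>q \<in> Q\<close> a] a]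
      by blast
  qed
  then have "(\<lambda>q. nxt q a) ` Q = Q"
    using a by (intro endo_inj_surj finite_Q) (auto simp: nxt_in_Q)
  then obtain q where "q \<in> Q" "r = nxt q a" using r(1) by blast
  then show ?case using r(2) by (intro bexI[of _ q]) simp_all
qed simp

text \<open>Preimages are built from the last entry forward: the tail \<open>p\<close> fixes the
  word \<open>act p w\<close> that the next state must read.\<close>

lemma section_of_surj:
  assumes "w \<in> lists A" "s \<in> lists Q"
  shows "\<exists>p\<in>lists Q. section_of p w = s"
  using assms(2)
proof (induction s)
  case Nil
  show ?case by (rule bexI[of _ "[]"]) auto
next
  case (Cons q s)
  then obtain p where p: "p \<in> lists Q" "section_of p w = s" by auto
  obtain r where "r \<in> Q" "target r (act p w) = q"
    using target_surj[OF act_in_lists[OF p(1) assms(1)]] Cons by auto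
  then show ?case using p by (intro bexI[of _ "r # p"]) auto
qed

text \<open>Every sequence is a section at \<open>u\<close>, so each generated function is already
  given by the section of some \<open>r\<close> in \<open>R\<close>.\<close>

lemma generated_semigroup_finite:
  assumes "u \<in> lists A" "finite R"
    and "\<And>p. p \<in> lists Q \<Longrightarrow>
      \<exists>r\<in>R. \<forall>x\<in>lists A. act (section_of p u) x = act (section_of r u) x"
  shows "finite (generated_semigroup T)"
proof (rule finite_subset)
  show "finite ((\<lambda>r. restrict (act (section_of r u)) (lists A)) ` R)"
    using assms(2) by simp
  show "generated_semigroup T \<subseteq> (\<lambda>r. restrict (act (section_of r u)) (lists A)) ` R"
  proof
    fix f assume "f \<in> generated_semigroup T"
    then obtain s where s: "s \<in> lists Q" "f = seq_fun T s"
      by (auto simp: generated_semigroup_def)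
    obtain p where p: "p \<in> lists Q" "section_of p u = s"
      using section_of_surj[OF assms(1) s(1)] by blast
    obtain r where "r \<in> R" "\<forall>x\<in>lists A. act s x = act (section_of r u) x"
      using assms(3)[OF p(1)] p(2) by blast
    moreover from this have "f = restrict (act (section_of r u)) (lists A)"
      unfolding s(2) seq_fun_eq[OF s(1)] by (intro restrict_ext) auto
    ultimately show "f \<in> (\<lambda>r. restrict (act (section_of r u)) (lists A)) ` R" by blast
  qed
qed

lemma expandable_short:
  assumes inf: "infinite (generated_semigroup T)" and u: "u \<in> lists A"
  shows "\<exists>x\<in>lists A. length x \<le> card Q ^ card (orbit T u) \<and> expandable T u x"
proof -
  obtain R where R: "R \<subseteq> lists Q" "[] \<in> R" "\<forall>q p. q # p \<in> R \<longrightarrow> p \<in> R"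
    and bij: "bij_betw (\<lambda>p. act p u) R (orbit T u)"
    using suffix_closed_transversal[OF u] .
  have finR: "finite R" and cardR: "card R = card (orbit T u)"
    using bij_betw_finite[OF bij] bij_betw_same_card[OF bij] finite_orbit[OF u] by auto
  \<comment> \<open>Equivalently, \<open>p\<close> and \<open>r\<close> act alike on all words over
    the alphabet that extend \<open>u\<close>.\<close>
  define same where "same p r \<longleftrightarrow> act p u = act r u \<and>
    (\<forall>x\<in>lists A. act (section_of p u) x = act (section_of r u) x)" for p r
  have "\<exists>q\<in>Q. \<exists>r\<in>R. \<forall>r'\<in>R. \<not> same (q # r) r'"
  proof (rule ccontr)
    assume "\<not> ?thesis"
    then have edge: "\<exists>r'\<in>R. same (q # r) r'" if "q \<in> Q" "r \<in> R" for q r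
      using that by blast
    have "\<exists>r\<in>R. same p r" if "p \<in> lists Q" for p
      using that
    proof (induction p)
      case Nil
      show ?case using R(2) by (intro bexI[of _ "[]"]) (simp_all add: same_def)
    next
      case (Cons q p)
      then obtain r where r: "r \<in> R" "same p r" by auto
      obtain r' where r': "r' \<in> R" "same (q # r) r'"
        using edge[of q r] Cons.hyps r(1) by blast
      \<comment> \<open>\<open>same\<close> is transitive and is preserved when \<open>q\<close> is
        put in front of both sequences.\<close>
      have "same (q # p) r'"
        using r(2) r'(2) by (auto simp: same_def)
      then show ?case using r' by blast
    qed
    then have "finite (generated_semigroup T)"
      by (intro generated_semigroup_finite[OF u finR]) (unfold same_def, blast)
    then show False using inf by simp
  qed
  then obtain q r where qr: "q \<in> Q" "r \<in> R"
    and nsame: "\<And>r'. r' \<in> R \<Longrightarrow> \<not> same (q # r) r'"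
    by blast
  let ?e = "q # r" and ?D = "insert (q # r) (R - {[]})"
  have eQ: "?e \<in> lists Q" using qr R(1) by auto
  then have "act ?e u \<in> orbit T u" unfolding orbit_eq[OF u] by (rule imageI)
  then have "act ?e u \<in> (\<lambda>p. act p u) ` R"
    by (simp only: bij_betw_imp_surj_on[OF bij])
  then obtain r' where r': "r' \<in> R" "act ?e u = act r' u" by blast
  \<comment> \<open>The images of \<open>u\<close> agree, so only the sections can make
    \<open>same\<close> fail.\<close>
  then obtain x where x: "x \<in> lists A" "act (section_of ?e u) x \<noteq> act (section_of r' u) x"
    using nsame[OF r'(1)] unfolding same_def by blast
  \<comment> \<open>Reflexivity puts \<open>?e\<close> outside \<open>R\<close>. Trading
    \<open>[]\<close>, whose section has no head, for \<open>?e\<close> keeps the cardinality, which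
    gives the exponent of the bound.\<close>
  have "same ?e ?e" by (simp add: same_def)
  then have "?e \<notin> R" using nsame by blast
  then have cardD: "card ?D = card (orbit T u)"
    using finR R(2) cardR card_Suc_Diff1[OF finR R(2)] by simp
  obtain y where y: "y \<in> lists A" "length y \<le> card Q ^ card ?D"
    "act (section_of ?e u) y \<noteq> act (section_of r' u) y"
  proof (rule short_distinguishing_word[of ?D ?e r' u x])
    show "finite ?D" using finR by simp
    show "?D \<subseteq> lists Q" using R(1) eQ by blast
    show "\<forall>q' p. q' # p \<in> ?D \<longrightarrow> p = [] \<or> p \<in> ?D" using R(3) qr(2) by blast
    show "r' = [] \<or> r' \<in> ?D" using r'(1) by blast
  qed (use u x in simp_all)
  have "act ?e (u @ y) \<noteq> act r' (u @ y)"
    using y(3) r'(2) by (simp only: act_append same_append_eq not_False_eq_True)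
  moreover have "r' \<in> lists Q" using r'(1) R(1) by blast
  ultimately have "expandable T u y"
    using expandableI[OF u y(1) eQ] r'(2) by blast
  then show ?thesis using y(1,2) unfolding cardD by blast
qed

end

end

theorem theorem5p3:
  fixes T :: "('q, 'a) automaton"
  assumes "S_automaton T"
    and "complete_automaton T"
    and "reversible_automaton T"
    and "infinite (generated_semigroup T)"
  shows "\<forall>u\<in>lists (alphabet T). \<exists>x\<in>lists (alphabet T).
           length x \<le> card (states T) ^ card (orbit T u) \<and> expandable T u x"
proof -
  interpret complete_S_automaton T
    using assms by unfold_locales
  show ?thesis using expandable_short assms by blast
qed

end
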